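(* Let $G$ be a finite abelian group of order $n \geq 2$, and let $C \subseteq G$ be a subset of size $|C| = k$. If $$0 < k \leq \frac{2^{2/3} n^{1/3}}{(3e \log n)^{2/3}},$$ then $C$ is a minimal complement in $G$. Consequently, for every $n \geq 2$, $$T(n) \geq \frac{n^{1/3}}{2(\log n/\log 2)^{2/3}}.$$
   Context: Here $\log$ is the natural logarithm. For subsets $A,B$ of an abelian group $G$, $A+B=\{a+b : a\in A, b\in B\}$. A subset $C \subseteq G$ is a complement for $W \subseteq G$ if $W + C = G$; it is a minimal complement for $W$ if moreover no proper subset of $C$ is a complement for $W$. $C$ is called a minimal complement in $G$ if it is a minimal complement for some $W \subseteq G$. For a finite abelian group $G$, $T(G)$ denotes the greatest integer $T$ with $0\le T\le |G|$ such that every non-empty subset $C \subseteq G$ with $|C| \leq T$ is a minimal complement in $G$; $T(n)$ is the minimum of $T(G)$ over all abelian groups $G$ of order $n$. *)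

theory Defs
  imports Complex_Main "HOL-Algebra.Algebra"
begin

text \<open>
  Groups are written multiplicatively, as in the library: the sumset \<open>A + B\<close> is the set
  product \<open>A <#>\<^bsub>G\<^esub> B\<close>.
\<close>

definition complement_for :: "('a, 'b) monoid_scheme \<Rightarrow> 'a set \<Rightarrow> 'a set \<Rightarrow> bool" where
  "complement_for G W C \<longleftrightarrow>
     W \<subseteq> carrier G \<and> C \<subseteq> carrier G \<and> W <#>\<^bsub>G\<^esub> C = carrier G"

definition minimal_complement_for :: "('a, 'b) monoid_scheme \<Rightarrow> 'a set \<Rightarrow> 'a set \<Rightarrow> bool" where
  "minimal_complement_for G W C \<longleftrightarrow>
     complement_for G W C \<and> (\<forall>C'. C' \<subset> C \<longrightarrow> \<not> complement_for G W C')"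

definition minimal_complement_in :: "('a, 'b) monoid_scheme \<Rightarrow> 'a set \<Rightarrow> bool" where
  "minimal_complement_in G C \<longleftrightarrow> (\<exists>W. W \<subseteq> carrier G \<and> minimal_complement_for G W C)"

definition T_group :: "('a, 'b) monoid_scheme \<Rightarrow> nat" where
  "T_group G = (GREATEST T. T \<le> order G \<and>
     (\<forall>C. C \<subseteq> carrier G \<and> C \<noteq> {} \<and> card C \<le> T \<longrightarrow> minimal_complement_in G C))"

text \<open>
  A definition cannot range over all types, so the minimum is taken over the groups whose
  carrier is a set of natural numbers. Every finite group is isomorphic to one of these, and
  \<open>T_group\<close> is invariant under isomorphism; see \<open>T_order_le_T_group\<close> below.
\<close>

definition T_order :: "nat \<Rightarrow> nat" where
  "T_order n = Min {T_group G | G :: nat monoid.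
     comm_group G \<and> finite (carrier G) \<and> order G = n}"

lemma minimal_complement_in_iso:
  assumes h: "h \<in> iso G H" and C: "minimal_complement_in G C"
  shows "minimal_complement_in H (h ` C)"
proof -
  from h have hom: "h \<in> hom G H" and bij: "bij_betw h (carrier G) (carrier H)"
    by (auto simp: iso_def)
  then have inj: "inj_on h (carrier G)" and img: "h ` carrier G = carrier H"
    by (auto simp: bij_betw_def)
  have mult: "h ` (A <#>\<^bsub>G\<^esub> B) = (h ` A) <#>\<^bsub>H\<^esub> (h ` B)"
    if "A \<subseteq> carrier G" "B \<subseteq> carrier G" for A B
    using set_mult_hom[OF hom] that by simp
  from C obtain W where W: "W \<subseteq> carrier G" and WC: "complement_for G W C"
    and min: "\<And>C'. C' \<subset> C \<Longrightarrow> \<not> complement_for G W C'"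
    by (auto simp: minimal_complement_in_def minimal_complement_for_def)
  have sub: "C \<subseteq> carrier G" using WC by (simp add: complement_for_def)
  have 1: "complement_for H (h ` W) (h ` C)"
    using WC image_mono[OF W, of h] image_mono[OF sub, of h] mult[OF W sub] img
    by (simp add: complement_for_def)
  have 2: "\<not> complement_for H (h ` W) D" if D: "D \<subset> h ` C" for D
  proof
    assume a: "complement_for H (h ` W) D"
    from D obtain C' where C': "C' \<subseteq> C" "D = h ` C'" by (meson psubset_imp_subset subset_imageE)
    with D have "C' \<subset> C" by auto
    have c: "C' \<subseteq> carrier G" using C' sub by auto
    have "W <#>\<^bsub>G\<^esub> C' \<subseteq> W <#>\<^bsub>G\<^esub> C" using C' by (auto simp: set_mult_def)
    then have "W <#>\<^bsub>G\<^esub> C' \<subseteq> carrier G" using WC by (simp add: complement_for_def)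
    moreover have "h ` (W <#>\<^bsub>G\<^esub> C') = h ` carrier G"
      using a C' mult[OF W c] img by (simp add: complement_for_def)
    ultimately have "W <#>\<^bsub>G\<^esub> C' = carrier G"
      using inj_on_image_eq_iff[OF inj] by blast
    then have "complement_for G W C'" using W c by (simp add: complement_for_def)
    with min \<open>C' \<subset> C\<close> show False by blast
  qed
  have "h ` W \<subseteq> carrier H" using W img by auto
  with 1 2 show ?thesis
    unfolding minimal_complement_in_def minimal_complement_for_def by blast
qed

lemma all_minimal_complement_in_iso:
  assumes h: "h \<in> iso G H"
    and all: "\<forall>C. C \<subseteq> carrier G \<and> C \<noteq> {} \<and> card C \<le> T \<longrightarrow> minimal_complement_in G C"
  shows "\<forall>D. D \<subseteq> carrier H \<and> D \<noteq> {} \<and> card D \<le> T \<longrightarrow> minimal_complement_in H D"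
proof (intro allI impI, elim conjE)
  fix D assume D: "D \<subseteq> carrier H" "D \<noteq> {}" "card D \<le> T"
  have bij: "inj_on h (carrier G)" "h ` carrier G = carrier H"
    using h by (auto simp: iso_def bij_betw_def)
  obtain C where C: "C \<subseteq> carrier G" "D = h ` C" using D(1) bij(2) by (metis subset_imageE)
  have "card C = card D" using C bij(1) by (metis card_image inj_on_subset)
  then have "minimal_complement_in G C" using all C D by auto
  then show "minimal_complement_in H D" using minimal_complement_in_iso[OF h] C by simp
qed

lemma T_group_iso:
  assumes G: "group G" and iso: "G \<cong> H"
  shows "T_group G = T_group H"
proof -
  obtain h where h: "h \<in> iso G H" using iso by (auto simp: is_iso_def)
  obtain g where g: "g \<in> iso H G" using group.iso_sym[OF G iso] by (auto simp: is_iso_def)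
  have ord: "order G = order H"
    using iso_same_card[OF iso] by (simp add: order_def)
  have "(\<forall>C. C \<subseteq> carrier G \<and> C \<noteq> {} \<and> card C \<le> T \<longrightarrow> minimal_complement_in G C) \<longleftrightarrow>
      (\<forall>C. C \<subseteq> carrier H \<and> C \<noteq> {} \<and> card C \<le> T \<longrightarrow> minimal_complement_in H C)" for T
    using all_minimal_complement_in_iso[OF h, of T] all_minimal_complement_in_iso[OF g, of T]
    by (rule iffI)
  then show ?thesis
    unfolding T_group_def ord by (simp only:)
qed

lemma T_order_le_T_group:
  assumes G: "comm_group G" and fin: "finite (carrier G)"
  shows "T_order (order G) \<le> T_group G"
proof -
  interpret G: comm_group G by fact
  obtain h :: "'a \<Rightarrow> nat" where inj: "inj_on h (carrier G)"
    using finite_imp_inj_to_nat_seg[OF fin] by blast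
  let ?g = "inv_into (carrier G) h"
  define H :: "nat monoid" where
    "H = \<lparr>carrier = h ` carrier G, monoid.mult = (\<lambda>x y. h (?g x \<otimes>\<^bsub>G\<^esub> ?g y)), one = h \<one>\<^bsub>G\<^esub>\<rparr>"
  have H: "comm_group H"
  proof (rule comm_groupI)
    fix x assume "x \<in> carrier H"
    then obtain a where a: "a \<in> carrier G" "x = h a" by (auto simp: H_def)
    show "\<exists>y\<in>carrier H. y \<otimes>\<^bsub>H\<^esub> x = \<one>\<^bsub>H\<^esub>"
      by (rule bexI[of _ "h (inv\<^bsub>G\<^esub> a)"]) (use a inj in \<open>auto simp: H_def\<close>)
  next
    fix x y assume "x \<in> carrier H" "y \<in> carrier H"
    then show "x \<otimes>\<^bsub>H\<^esub> y = y \<otimes>\<^bsub>H\<^esub> x"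
      using inj by (auto simp: H_def intro!: arg_cong[where f = h] G.m_comm)
  next
    fix x y z assume "x \<in> carrier H" "y \<in> carrier H" "z \<in> carrier H"
    then show "x \<otimes>\<^bsub>H\<^esub> y \<otimes>\<^bsub>H\<^esub> z = x \<otimes>\<^bsub>H\<^esub> (y \<otimes>\<^bsub>H\<^esub> z)"
      using inj by (auto simp: H_def intro!: arg_cong[where f = h] G.m_assoc)
  qed (use inj in \<open>auto simp: H_def\<close>)
  have "h \<in> iso G H"
    using inj by (auto simp: iso_def hom_def bij_betw_def H_def)
  then have iso: "G \<cong> H" by (auto simp: is_iso_def)
  have finH: "finite (carrier H)" using fin by (simp add: H_def)
  have ord: "order H = order G" using iso_same_card[OF iso] by (simp add: order_def)
  let ?S = "{T_group K | K :: nat monoid. comm_group K \<and> finite (carrier K) \<and> order K = order G}"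
  have "T_group K \<le> order K" if K: "finite (carrier K)" for K :: "nat monoid"
  proof -
    let ?P = "\<lambda>T. T \<le> order K \<and>
      (\<forall>C. C \<subseteq> carrier K \<and> C \<noteq> {} \<and> card C \<le> T \<longrightarrow> minimal_complement_in K C)"
    have "?P 0" using K by (auto dest: finite_subset)
    then have "?P (Greatest ?P)" by (rule GreatestI_nat[where b = "order K"]) simp
    then show ?thesis unfolding T_group_def by simp
  qed
  then have "?S \<subseteq> {..order G}" by force
  then have "finite ?S" by (rule finite_subset) simp
  moreover have "T_group H \<in> ?S" using H finH ord by blast
  ultimately have "Min ?S \<le> T_group H" by (rule Min_le)
  then show ?thesis
    using T_group_iso[OF G.is_group iso] by (simp add: T_order_def)
qed

end

theory Submission
  imports Defs
begin

text \<open>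
  If \<open>W \<cdot> C = G\<close> and every \<open>c \<in> C\<close> has a point \<open>g\<^sub>c\<close> that only \<open>c\<close> reaches, then \<open>W\<close> avoids the set
  \<open>F\<close> of all \<open>g\<^sub>c c'\<inverse>\<close> with \<open>c \<noteq> c'\<close>. Conversely \<open>W = G - F\<close> works as soon as \<open>F\<close> contains
  no set \<open>h C\<inverse>\<close>. Suppose it does contain one, and fix \<open>q \<in> C\<close>. Then \<open>h q\<inverse> = g\<^sub>c a\<inverse>\<close> for some
  \<open>a \<noteq> c\<close>. The \<open>|C| - 1\<close> points \<open>g\<^sub>c c'\<inverse>\<close> cannot cover \<open>h C\<inverse>\<close>, so a point \<open>h p\<inverse>\<close>, with \<open>p\<close>
  depending only on \<open>c\<close> and \<open>a\<close>, equals \<open>g\<^sub>d b\<inverse>\<close> for some \<open>d \<noteq> c\<close>. Hence \<open>g\<^sub>d g\<^sub>c\<inverse>\<close> lies in a set of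
  at most \<open>|C| (|C| - 1)\<close> elements depending only on \<open>c\<close>. A greedy choice of the \<open>g\<^sub>c\<close> avoids all
  these sets when \<open>2 |C| (|C| - 1)\<^sup>2 < |G|\<close>. This is stronger than the logarithmic bounds
  and leaves room for rounding up in the bound on \<open>T\<close>.
\<close>

section \<open>Greedy choice of group elements\<close>

text \<open>Values are chosen one index at a time. Each earlier index rules out at most
  \<open>2 * m\<close> values for the new one, since both orders of the quotient must be
  avoided.\<close>

lemma (in group) greedy_avoiding_quotients:
  assumes "finite I"
    and "\<And>c. c \<in> I \<Longrightarrow> D c \<subseteq> carrier G" "\<And>c. c \<in> I \<Longrightarrow> card (D c) \<le> m"
    and "2 * m * (card I - 1) < order G"
  shows "\<exists>g. g ` I \<subseteq> carrier G \<and> (\<forall>c\<in>I. \<forall>d\<in>I. c \<noteq> d \<longrightarrow> g d \<otimes> inv (g c) \<notin> D c)"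
  using assms
proof (induction I rule: finite_induct)
  case empty
  then show ?case by simp
next
  case (insert i I)
  have less: "2 * m * card I < order G"
    using insert.prems(3) insert.hyps by simp
  \<comment> \<open>An infinite carrier has \<open>order\<close> 0, which the strict bound
    excludes.\<close>
  then have fin: "finite (carrier G)"
    by (metis card.infinite less_nat_zero_code order_def)
  have "2 * m * (card I - 1) \<le> 2 * m * card I" by simp
  with less have "2 * m * (card I - 1) < order G" by linarith
  then obtain g where g: "g ` I \<subseteq> carrier G"
    and avoid: "\<And>c d. c \<in> I \<Longrightarrow> d \<in> I \<Longrightarrow> c \<noteq> d \<Longrightarrow> g d \<otimes> inv (g c) \<notin> D c"
    using insert.IH insert.prems(1,2) by auto
  have finD: "finite (D c)" if "c \<in> insert i I" for c
    using insert.prems(1)[OF that] fin by (rule finite_subset)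
  \<comment> \<open>\<open>B\<close> holds the forbidden values \<open>y\<close> at
    \<open>i\<close>: the first image solves \<open>y \<otimes> inv (g l) \<in> D l\<close>, the
    second solves \<open>g l \<otimes> inv y \<in> D i\<close>.\<close>
  define B where
    "B = (\<Union>l\<in>I. (\<lambda>x. x \<otimes> g l) ` D l \<union> (\<lambda>x. inv x \<otimes> g l) ` D i)"
  have "card B \<le> (\<Sum>l\<in>I. card ((\<lambda>x. x \<otimes> g l) ` D l \<union> (\<lambda>x. inv x \<otimes> g l) ` D i))"
    unfolding B_def by (rule card_UN_le) fact
  also have "\<dots> \<le> (\<Sum>l\<in>I. 2 * m)"
  proof (rule sum_mono)
    fix l assume "l \<in> I"
    then have "card ((\<lambda>x. x \<otimes> g l) ` D l) \<le> m" "card ((\<lambda>x. inv x \<otimes> g l) ` D i) \<le> m"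
      using card_image_le[OF finD] insert.prems(2) by (meson insertCI le_trans)+
    then show "card ((\<lambda>x. x \<otimes> g l) ` D l \<union> (\<lambda>x. inv x \<otimes> g l) ` D i) \<le> 2 * m"
      using card_Un_le[of "(\<lambda>x. x \<otimes> g l) ` D l" "(\<lambda>x. inv x \<otimes> g l) ` D i"] by linarith
  qed
  finally have "card B < card (carrier G)"
    using less by (simp add: order_def mult.commute)
  moreover have "finite B"
    using finD insert.hyps by (auto simp: B_def)
  ultimately obtain y where y: "y \<in> carrier G" "y \<notin> B"
    by (meson card_mono leD subsetI)
  have 1: "y \<otimes> inv (g l) \<notin> D l" if "l \<in> I" for l
  proof
    assume a: "y \<otimes> inv (g l) \<in> D l"
    have "y = (y \<otimes> inv (g l)) \<otimes> g l"
      using y g that by (simp add: image_subset_iff m_assoc)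
    with a y that show False unfolding B_def by blast
  qed
  have 2: "g l \<otimes> inv y \<notin> D i" if "l \<in> I" for l
  proof
    assume a: "g l \<otimes> inv y \<in> D i"
    have "y = inv (g l \<otimes> inv y) \<otimes> g l"
      using y g that by (simp add: image_subset_iff inv_mult_group m_assoc)
    with a y that show False unfolding B_def by blast
  qed
  have "g(i := y) ` insert i I \<subseteq> carrier G"
    using y g by auto
  moreover have "\<forall>c\<in>insert i I. \<forall>d\<in>insert i I. c \<noteq> d \<longrightarrow>
      (g(i := y)) d \<otimes> inv ((g(i := y)) c) \<notin> D c"
    using 1 2 avoid insert.hyps by auto
  ultimately show ?case by blast
qed

section \<open>Combinatorial criterion for minimal complements\<close>

lemma (in comm_group) minimal_complement_in_if_translate_avoiding:
  assumes C: "C \<subseteq> carrier G" and g: "g ` C \<subseteq> carrier G"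
    and F: "\<And>h. h \<in> carrier G \<Longrightarrow>
      \<exists>p\<in>C. \<forall>c\<in>C. \<forall>a\<in>C. c \<noteq> a \<longrightarrow> h \<otimes> inv p \<noteq> g c \<otimes> inv a"
  shows "minimal_complement_in G C"
proof -
  define W where "W = carrier G - {g c \<otimes> inv a |c a. c \<in> C \<and> a \<in> C \<and> c \<noteq> a}"
  have W: "W \<subseteq> carrier G" by (auto simp: W_def)
  have "h \<in> W <#> C" if h: "h \<in> carrier G" for h
  proof -
    obtain p where p: "p \<in> C" "\<forall>c\<in>C. \<forall>a\<in>C. c \<noteq> a \<longrightarrow> h \<otimes> inv p \<noteq> g c \<otimes> inv a"
      using F[OF h] by blast
    have "h \<otimes> inv p \<in> carrier G" using C h p(1) by blast
    then have "h \<otimes> inv p \<in> W" using p(2) unfolding W_def by blast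
    moreover have "h = (h \<otimes> inv p) \<otimes> p"
      using h p(1) C by (simp add: m_assoc subset_iff)
    ultimately show ?thesis using p(1) by (auto simp: set_mult_def)
  qed
  then have "complement_for G W C"
    using W C set_mult_closed[OF W C] by (auto simp: complement_for_def)
  moreover have "\<not> complement_for G W C'" if C': "C' \<subset> C" for C'
  proof
    assume "complement_for G W C'"
    then have all: "W <#> C' = carrier G" by (simp add: complement_for_def)
    obtain c where c: "c \<in> C" "c \<notin> C'" using C' by blast
    then have "g c \<in> W <#> C'" using all g by auto
    then obtain w a where wa: "w \<in> W" "a \<in> C'" "g c = w \<otimes> a"
      by (auto simp: set_mult_def)
    then have "w \<in> carrier G" "a \<in> carrier G" using W C C' by auto
    then have "w = g c \<otimes> inv a" unfolding wa(3) by (simp add: m_assoc)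
    moreover have "a \<in> C" "c \<noteq> a" using wa(2) c C' by auto
    ultimately show False using wa(1) c(1) unfolding W_def by blast
  qed
  ultimately show ?thesis
    using W unfolding minimal_complement_in_def minimal_complement_for_def by blast
qed

lemma (in comm_group) minimal_complement_in_if_order_gt:
  assumes C: "C \<subseteq> carrier G" "C \<noteq> {}"
    and less: "2 * card C * (card C - 1)^2 < order G"
  shows "minimal_complement_in G C"
proof -
  have "finite (carrier G)"
    using less by (metis card.infinite less_nat_zero_code order_def)
  then have fin: "finite C" using C by (auto dest: finite_subset)
  obtain q where q: "q \<in> C" using C by blast
  \<comment> \<open>Pigeonhole. If \<open>h \<otimes> inv q = g c \<otimes> inv a\<close>, then
    \<open>h \<otimes> inv p\<close> is \<open>g c\<close> times the element on the left, so this
    \<open>p\<close> keeps it away from every \<open>g c \<otimes> inv b\<close> with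
    \<open>b \<noteq> c\<close>.\<close>
  have "\<exists>p\<in>C. inv a \<otimes> q \<otimes> inv p \<notin> (\<lambda>x. inv x) ` (C - {c})" if "c \<in> C" "a \<in> C" for a c
  proof (rule ccontr)
    assume "\<not> ?thesis"
    then have sub: "(\<lambda>p. inv a \<otimes> q \<otimes> inv p) ` C \<subseteq> (\<lambda>x. inv x) ` (C - {c})" by auto
    have "inj_on (\<lambda>p. inv a \<otimes> q \<otimes> inv p) C"
      using C q that by (auto intro!: inj_onI simp: subset_iff)
    then have "card C = card ((\<lambda>p. inv a \<otimes> q \<otimes> inv p) ` C)"
      by (simp add: card_image)
    also have "\<dots> \<le> card ((\<lambda>x. inv x) ` (C - {c}))"
      using fin sub by (intro card_mono) auto
    also have "\<dots> \<le> card (C - {c})"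
      using fin by (intro card_image_le) auto
    also have "\<dots> < card C" using fin that by (intro card_Diff1_less)
    finally show False by simp
  qed
  then obtain p where p: "\<And>c a. c \<in> C \<Longrightarrow> a \<in> C \<Longrightarrow> p c a \<in> C"
    and p_notin: "\<And>c a. c \<in> C \<Longrightarrow> a \<in> C \<Longrightarrow> inv a \<otimes> q \<otimes> inv (p c a) \<notin> (\<lambda>x. inv x) ` (C - {c})"
    by metis
  \<comment> \<open>These are the values of \<open>g d \<otimes> inv (g c)\<close> that a bad
    \<open>h\<close> would force. They do not involve \<open>g\<close>, so the greedy choice
    applies.\<close>
  define D where "D c = (\<lambda>(a, b). inv a \<otimes> q \<otimes> inv (p c a) \<otimes> b) ` ((C - {c}) \<times> C)" for c
  have D: "D c \<subseteq> carrier G" if "c \<in> C" for c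
    using that p q C unfolding D_def by (auto simp: subset_iff)
  have cardD: "card (D c) \<le> (card C - 1) * card C" if "c \<in> C" for c
  proof -
    have "card (D c) \<le> card ((C - {c}) \<times> C)"
      unfolding D_def using fin by (intro card_image_le) auto
    then show ?thesis using that fin by (simp add: card_cartesian_product)
  qed
  have "2 * ((card C - 1) * card C) * (card C - 1) < order G"
    using less by (simp add: power2_eq_square mult_ac)
  then obtain g where g: "g ` C \<subseteq> carrier G"
    and avoid: "\<And>c d. c \<in> C \<Longrightarrow> d \<in> C \<Longrightarrow> c \<noteq> d \<Longrightarrow> g d \<otimes> inv (g c) \<notin> D c"
    using greedy_avoiding_quotients[of C D "(card C - 1) * card C"] fin D cardD by auto
  show ?thesis
  proof (rule minimal_complement_in_if_translate_avoiding[OF C(1) g], rule ccontr)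
    fix h assume h: "h \<in> carrier G"
      and "\<not> (\<exists>p\<in>C. \<forall>c\<in>C. \<forall>a\<in>C. c \<noteq> a \<longrightarrow> h \<otimes> inv p \<noteq> g c \<otimes> inv a)"
    then have cov: "\<exists>c\<in>C. \<exists>a\<in>C. c \<noteq> a \<and> h \<otimes> inv p = g c \<otimes> inv a" if "p \<in> C" for p
      using that by blast
    obtain c a where ca: "c \<in> C" "a \<in> C" "c \<noteq> a" "h \<otimes> inv q = g c \<otimes> inv a"
      using cov[OF q] by blast
    obtain d b where db: "d \<in> C" "b \<in> C" "d \<noteq> b" "h \<otimes> inv (p c a) = g d \<otimes> inv b"
      using cov[OF p[OF ca(1,2)]] by blast
    have closed: "q \<in> carrier G" "a \<in> carrier G" "b \<in> carrier G" "p c a \<in> carrier G"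
      "g c \<in> carrier G" "g d \<in> carrier G"
      using q ca db p[OF ca(1,2)] C g by auto
    have "h = h \<otimes> inv q \<otimes> q"
      using closed h by (simp add: m_assoc)
    then have "h = g c \<otimes> inv a \<otimes> q"
      unfolding ca(4) .
    then have gd: "g c \<otimes> (inv a \<otimes> q \<otimes> inv (p c a)) = g d \<otimes> inv b"
      using db(4) closed by (simp add: m_assoc)
    have "d \<noteq> c"
    proof
      assume "d = c"
      then have "inv a \<otimes> q \<otimes> inv (p c a) = inv b"
        using gd closed by simp
      then show False using p_notin[OF ca(1,2)] db \<open>d = c\<close> by blast
    qed
    moreover have "g d \<otimes> inv (g c) = inv a \<otimes> q \<otimes> inv (p c a) \<otimes> b"
    proof -
      have "g d = g c \<otimes> (inv a \<otimes> q \<otimes> inv (p c a)) \<otimes> b"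
        using gd closed by (simp add: m_assoc)
      \<comment> \<open>Commutativity moves \<open>g c\<close> to the right, where it
        cancels.\<close>
      also have "\<dots> = (inv a \<otimes> q \<otimes> inv (p c a) \<otimes> b) \<otimes> g c"
        using closed by (simp add: m_ac)
      finally show ?thesis using closed by (simp add: m_assoc)
    qed
    then have "g d \<otimes> inv (g c) \<in> D c"
      using ca db by (auto simp: D_def intro!: image_eqI[where x = "(a, b)"])
    ultimately show False using avoid ca db by blast
  qed
qed

section \<open>The quantities \<open>T_group\<close> and \<open>T_order\<close>\<close>

lemma T_group_le_order:
  assumes "finite (carrier G)"
  shows "T_group G \<le> order G"
proof -
  let ?P = "\<lambda>T. T \<le> order G \<and>
    (\<forall>C. C \<subseteq> carrier G \<and> C \<noteq> {} \<and> card C \<le> T \<longrightarrow> minimal_complement_in G C)"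
  \<comment> \<open>Finiteness matters here: infinite sets also have \<open>card\<close> 0.\<close>
  have "?P 0" using assms by (auto dest: finite_subset)
  then have "?P (Greatest ?P)" by (rule GreatestI_nat[where b = "order G"]) simp
  then show ?thesis unfolding T_group_def by simp
qed

lemma le_T_groupI:
  assumes "T \<le> order G"
    and "\<And>C. C \<subseteq> carrier G \<Longrightarrow> C \<noteq> {} \<Longrightarrow> card C \<le> T \<Longrightarrow> minimal_complement_in G C"
  shows "T \<le> T_group G"
  unfolding T_group_def
  by (rule Greatest_le_nat[where b = "order G"]) (use assms in auto)

text \<open>The cyclic group shows that the set minimised in \<open>T_order\<close> is
  non-empty.\<close>

lemma comm_group_mod_add:
  fixes n :: nat
  assumes "0 < n"
  shows "comm_group \<lparr>carrier = {..<n}, monoid.mult = (\<lambda>x y. (x + y) mod n), one = 0\<rparr>"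
    (is "comm_group ?G")
proof (rule comm_groupI)
  fix x assume "x \<in> carrier ?G"
  then show "\<exists>y\<in>carrier ?G. y \<otimes>\<^bsub>?G\<^esub> x = \<one>\<^bsub>?G\<^esub>"
    using assms by (intro bexI[of _ "(n - x) mod n"]) (auto simp: mod_add_left_eq)
next
  fix x y z
  show "x \<otimes>\<^bsub>?G\<^esub> y \<otimes>\<^bsub>?G\<^esub> z = x \<otimes>\<^bsub>?G\<^esub> (y \<otimes>\<^bsub>?G\<^esub> z)"
    by (simp add: mod_add_left_eq mod_add_right_eq add.assoc)
qed (use assms in \<open>auto simp: add.commute\<close>)

lemma T_order_in:
  assumes "0 < n"
  obtains G :: "nat monoid" where "comm_group G" "finite (carrier G)" "order G = n"
    "T_order n = T_group G"
proof -
  let ?S = "{T_group G | G :: nat monoid. comm_group G \<and> finite (carrier G) \<and> order G = n}"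
  let ?G = "\<lparr>carrier = {..<n}, monoid.mult = (\<lambda>x y. (x + y) mod n), one = 0\<rparr>"
  have "?S \<subseteq> {..n}" using T_group_le_order by force
  then have "finite ?S" by (rule finite_subset) simp
  moreover have "T_group ?G \<in> ?S"
    using comm_group_mod_add[OF assms] by (force simp: order_def)
  ultimately have "Min ?S \<in> ?S" by (intro Min_in) auto
  then show ?thesis using that by (auto simp: T_order_def)
qed

section \<open>Numerical estimates and conclusion\<close>

lemma powr_one_third_power3: "0 \<le> x \<Longrightarrow> (x powr (1/3)) ^ 3 = x" for x :: real
  by (cases "x = 0") (simp_all add: powr_power)

lemma powr_two_thirds_power3: "0 \<le> x \<Longrightarrow> (x powr (2/3)) ^ 3 = x ^ 2" for x :: real
  by (cases "x = 0") (simp_all add: powr_power)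

text \<open>Cubing turns the bound into \<open>k ^ 3 * b ^ 2 \<le> 4 * n\<close> with
  \<open>b \<ge> 3\<close>, so \<open>n\<close> is at least \<open>9/4 * k ^ 3\<close>, which
  exceeds \<open>2 * k ^ 3\<close>.\<close>

lemma card_bound_imp_order_gt:
  fixes n k :: nat
  assumes n: "n \<ge> 2" and k: "0 < k"
    and le: "real k \<le> 2 powr (2/3) * real n powr (1/3) / (3 * exp 1 * ln (real n)) powr (2/3)"
  shows "2 * k * (k - 1)^2 < n"
proof -
  define b where "b = 3 * exp 1 * ln (real n)"
  have "ln (2::real) \<le> ln (real n)" using n by simp
  then have "1/2 \<le> ln (real n)"
    using ln_le_minus_one[of "1/2 :: real"] by (simp add: ln_div)
  moreover have "(2::real) \<le> exp 1" using exp_ge_add_one_self[of 1] by simp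
  ultimately have "2 * (1/2) \<le> exp 1 * ln (real n)" by (intro mult_mono) auto
  then have b: "3 \<le> b" by (simp add: b_def)
  have "real k ^ 3 \<le> (2 powr (2/3) * real n powr (1/3) / b powr (2/3)) ^ 3"
    using le unfolding b_def by (rule power_mono) simp
  also have "\<dots> = 4 * real n / b ^ 2"
    using b by (simp add: power_mult_distrib power_divide powr_one_third_power3
        powr_two_thirds_power3)
  finally have "real k ^ 3 * b ^ 2 \<le> 4 * real n"
    using b by (simp add: pos_le_divide_eq)
  moreover have "real k ^ 3 * 3 ^ 2 \<le> real k ^ 3 * b ^ 2"
    using b by (intro mult_left_mono power_mono) auto
  ultimately have "9 * real (k ^ 3) \<le> 4 * real n" by simp
  then have "9 * k ^ 3 \<le> 4 * n" by linarith
  moreover have "2 * k * (k - 1)^2 \<le> 2 * k * k^2"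
    by (intro mult_left_mono power_mono) auto
  moreover have "2 * k * k^2 = 2 * k ^ 3"
    by (simp add: power3_eq_cube power2_eq_square)
  moreover have "0 < k ^ 3" using k by simp
  ultimately show ?thesis by linarith
qed

text \<open>The hypothesis allows \<open>k\<close> to be the bound on \<open>T\<close> rounded up.\<close>

lemma card_lt_bound_plus_one_imp_order_gt:
  fixes n k :: nat
  assumes n: "n \<ge> 2" and k: "0 < k"
    and less: "real k < real n powr (1/3) / (2 * (ln (real n) / ln 2) powr (2/3)) + 1"
  shows "2 * k * (k - 1)^2 < n"
proof (cases "k = 1")
  case True
  then show ?thesis using n by simp
next
  case False
  define l where "l = ln (real n) / ln 2"
  have l: "1 \<le> l" using n by (simp add: l_def)
  have "real (k - 1) < real n powr (1/3) / (2 * l powr (2/3))"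
    using less k unfolding l_def by (simp add: of_nat_diff)
  then have "real (k - 1) ^ 3 < (real n powr (1/3) / (2 * l powr (2/3))) ^ 3"
    by (rule power_strict_mono) auto
  also have "\<dots> = real n / (8 * l ^ 2)"
    using l by (simp add: power_mult_distrib power_divide powr_one_third_power3
        powr_two_thirds_power3)
  also have "\<dots> \<le> real n / 8"
    using l by (intro divide_left_mono) auto
  finally have "8 * real ((k - 1) ^ 3) < real n" by simp
  then have "8 * (k - 1) ^ 3 < n" by linarith
  \<comment> \<open>From \<open>k \<ge> 2\<close> follows \<open>k \<le> 4 * (k - 1)\<close>; this
    fails at \<open>k = 1\<close>, hence the case split.\<close>
  moreover have "2 * k * (k - 1)^2 \<le> 8 * (k - 1) * (k - 1)^2"
    using k False by (intro mult_right_mono) auto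
  moreover have "8 * (k - 1) * (k - 1)^2 = 8 * (k - 1) ^ 3"
    by (simp add: power3_eq_cube power2_eq_square)
  ultimately show ?thesis by linarith
qed

lemma T_order_ge:
  assumes n: "n \<ge> 2"
  shows "real n powr (1/3) / (2 * (ln (real n) / ln 2) powr (2/3)) \<le> real (T_order n)"
    (is "?x \<le> _")
proof -
  obtain G :: "nat monoid" where G: "comm_group G" "order G = n" and T: "T_order n = T_group G"
    using T_order_in[of n] n by (metis not_numeral_le_zero gr0I)
  \<comment> \<open>\<open>T_group\<close> is capped by the order, so the rounded-up bound must
    first be shown to be at most \<open>n\<close>.\<close>
  have "1 \<le> ln (real n) / ln 2" using n by simp
  then have "1 \<le> 2 * (ln (real n) / ln 2) powr (2/3)"
    using ge_one_powr_ge_zero[of "ln (real n) / ln 2" "2/3"] by linarith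
  then have "?x \<le> real n powr (1/3) / 1"
    by (intro divide_left_mono) auto
  also have "\<dots> \<le> real n powr 1"
    using n unfolding div_by_1 by (intro powr_mono) auto
  finally have "?x \<le> real n" using n by simp
  \<comment> \<open>The ceiling is needed: an integer known only to be at least the floor of
    \<open>?x\<close> could lie below \<open>?x\<close>.\<close>
  then have "nat \<lceil>?x\<rceil> \<le> n" by linarith
  moreover have "minimal_complement_in G C"
    if C: "C \<subseteq> carrier G" "C \<noteq> {}" "card C \<le> nat \<lceil>?x\<rceil>" for C
  proof (rule comm_group.minimal_complement_in_if_order_gt[OF G(1) C(1,2)])
    have "finite (carrier G)"
      using G(2) n by (metis card.infinite not_numeral_le_zero order_def)
    then have "0 < card C" using C by (auto simp: card_gt_0_iff dest: finite_subset)
    moreover from this have "real (card C) < ?x + 1" using C(3) by linarith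
    ultimately show "2 * card C * (card C - 1)^2 < order G"
      using card_lt_bound_plus_one_imp_order_gt[OF n] G(2) by blast
  qed
  ultimately have "nat \<lceil>?x\<rceil> \<le> T_group G" using G(2) by (intro le_T_groupI) auto
  then show ?thesis unfolding T by linarith
qed

theorem theorem1p1:
  shows "(\<forall>(G :: ('a, 'b) monoid_scheme) (n :: nat) (C :: 'a set) (k :: nat).
            comm_group G \<and> finite (carrier G) \<and> order G = n \<and> n \<ge> 2 \<and>
            C \<subseteq> carrier G \<and> card C = k \<and> 0 < k \<and>
            real k \<le> 2 powr (2/3) * real n powr (1/3) / (3 * exp 1 * ln (real n)) powr (2/3)
            \<longrightarrow> minimal_complement_in G C)
       \<and> (\<forall>n :: nat. n \<ge> 2 \<longrightarrow>
            real (T_order n) \<ge> real n powr (1/3) / (2 * (ln (real n) / ln 2) powr (2/3)))"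
proof (intro conjI allI impI; (elim conjE)?)
  fix G :: "('a, 'b) monoid_scheme" and n k :: nat and C :: "'a set"
  assume G: "comm_group G" "order G = n" and n: "n \<ge> 2"
    and C: "C \<subseteq> carrier G" "card C = k" and k: "0 < k"
    and le: "real k \<le> 2 powr (2/3) * real n powr (1/3) / (3 * exp 1 * ln (real n)) powr (2/3)"
  have "C \<noteq> {}" using C k by auto
  then show "minimal_complement_in G C"
    using comm_group.minimal_complement_in_if_order_gt[OF G(1) C(1)]
      card_bound_imp_order_gt[OF n k le] G(2) C(2) by simp
qed (rule T_order_ge)

end
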